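(* Let $X\in\mathbb{R}^{n\times k}$ be a fixed matrix of full (column) rank, let $\sigma^2>0$ be known, and let $Y=(Y_1,\dots,Y_n)\sim N(X\theta,\sigma^2I_n)$ with $\theta=(\theta_a,\theta_b)\in\mathbb{R}^d\times\mathbb{R}^{k-d}$. Fix $\theta^*=(\theta_a^*,\theta_b^* )$ with $\theta_a^*\neq0$, and let $$\Theta_0=\{(0,\theta_b)\in\mathbb{R}^d\times\mathbb{R}^{k-d}\},\qquad\Theta_1=\{\theta^*\}.$$ Let $\widehat\theta(Y)=(X^\top X)^{-1}X^\top Y$ and $$\overline\theta=\operatorname*{argmin}_{\theta\in\Theta_0}\ (\theta^*-\theta)^\top\sigma^{-2}X^\top X(\theta^*-\theta).$$ Then the GRO e-variable for testing $\Theta_0$ against $\Theta_1$ based on $Y$ is $$E(Y)=\frac{\rho(\widehat\theta(Y);\theta^*,\sigma^2(X^\top X)^{-1})}{\rho(\widehat\theta(Y);\overline\theta,\sigma^2(X^\top X)^{-1})},$$ where $\rho(\cdot;m,\Sigma)$ is the Gaussian density with mean $m$ and covariance $\Sigma$.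
   Context: An e-variable for $\Theta_0$ is a $[0,\infty]$-valued measurable function $E=E(Y)$ of the data with $\mathbb{E}_\theta[E]\le1$ for all $\theta\in\Theta_0$, where $\mathbb{E}_\theta$ denotes expectation under $Y\sim N(X\theta,\sigma^2I_n)$. Let $\mathcal{E}$ denote the set of all such e-variables. For a point alternative $\Theta_1=\{\theta^*\}$, the GRO (growth-rate optimal, or log-optimal) e-variable is the element of $\mathcal{E}$ attaining $\sup_{E\in\mathcal{E}}\mathbb{E}_{\theta^*}[\log(E)]$. Here $\log0=-\infty$, $\log\infty=\infty$, and an expectation $\mathbb{E}[Z]$ is defined in $[-\infty,\infty]$ when $\mathbb{E}[Z^+]$ or $\mathbb{E}[Z^-]$ is finite (which is the case for $\log E$, $E\in\mathcal{E}$, under $\theta^*$ in this setting). *)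

theory Defs
  imports "HOL-Analysis.Analysis"
begin

definition gaussian_density :: "real ^ 'n \<Rightarrow> real ^ 'n ^ 'n \<Rightarrow> real ^ 'n \<Rightarrow> real" where
  "gaussian_density m S x =
     exp (- (((x - m) \<bullet> (matrix_inv S *v (x - m))) / 2)) / sqrt ((2 * pi) ^ CARD('n) * det S)"

(* meaningful for positive definite S only; degenerate Gaussians are not covered *)
definition gaussian_measure :: "real ^ 'n \<Rightarrow> real ^ 'n ^ 'n \<Rightarrow> (real ^ 'n) measure" where
  "gaussian_measure m S = density lborel (\<lambda>x. ennreal (gaussian_density m S x))"

(* law of Y under theta, i.e. N(X theta, s2 I_n); "mat s2" is s2 times the identity *)
definition linear_model :: "real ^ 'k ^ 'n \<Rightarrow> real \<Rightarrow> real ^ 'k \<Rightarrow> (real ^ 'n) measure" where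
  "linear_model X s2 \<theta> = gaussian_measure (X *v \<theta>) (mat s2)"

(* The block theta_a is given by its set A of coordinates (so d = card A), theta_b by the
   complement of A.  Unlike an index type 'd + 'b this includes the case d = k. *)
definition null_params :: "'k set \<Rightarrow> (real ^ 'k) set" where
  "null_params A = {\<theta>. \<forall>i\<in>A. \<theta> $ i = 0}"

definition least_squares :: "real ^ 'k ^ 'n \<Rightarrow> real ^ 'n \<Rightarrow> real ^ 'k" where
  "least_squares X y = (matrix_inv (transpose X ** X) ** transpose X) *v y"

definition weighted_dist :: "real ^ 'k ^ 'n \<Rightarrow> real \<Rightarrow> real ^ 'k \<Rightarrow> real ^ 'k \<Rightarrow> real" where
  "weighted_dist X s2 \<theta>s \<theta> =
     (\<theta>s - \<theta>) \<bullet> ((inverse s2 *\<^sub>R (transpose X ** X)) *v (\<theta>s - \<theta>))"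

definition ln_ennreal :: "ennreal \<Rightarrow> ereal" where
  "ln_ennreal x = (if x = 0 then - \<infinity> else if x = \<infinity> then \<infinity> else ereal (ln (enn2real x)))"

(* e2ennreal maps negative values to 0, so these are the integrals of the
   positive and of the negative part *)
definition ext_expectation_defined :: "'y measure \<Rightarrow> ('y \<Rightarrow> ereal) \<Rightarrow> bool" where
  "ext_expectation_defined M Z \<longleftrightarrow>
     (\<integral>\<^sup>+ y. e2ennreal (Z y) \<partial>M) < \<infinity> \<or> (\<integral>\<^sup>+ y. e2ennreal (- Z y) \<partial>M) < \<infinity>"

definition ext_expectation :: "'y measure \<Rightarrow> ('y \<Rightarrow> ereal) \<Rightarrow> ereal" where
  "ext_expectation M Z =
     enn2ereal (\<integral>\<^sup>+ y. e2ennreal (Z y) \<partial>M) - enn2ereal (\<integral>\<^sup>+ y. e2ennreal (- Z y) \<partial>M)"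

definition e_variables ::
  "('p \<Rightarrow> 'y::topological_space measure) \<Rightarrow> 'p set \<Rightarrow> ('y \<Rightarrow> ennreal) set" where
  "e_variables P \<Theta>0 =
     {E. E \<in> borel_measurable borel \<and> (\<forall>\<theta>\<in>\<Theta>0. (\<integral>\<^sup>+ y. E y \<partial>P \<theta>) \<le> 1)}"

definition is_gro ::
  "('p \<Rightarrow> 'y::topological_space measure) \<Rightarrow> 'p set \<Rightarrow> 'p \<Rightarrow> ('y \<Rightarrow> ennreal) \<Rightarrow> bool" where
  "is_gro P \<Theta>0 \<theta>s E \<longleftrightarrow>
     E \<in> e_variables P \<Theta>0 \<and>
     ext_expectation (P \<theta>s) (\<lambda>y. ln_ennreal (E y)) =
       (SUP F\<in>e_variables P \<Theta>0. ext_expectation (P \<theta>s) (\<lambda>y. ln_ennreal (F y)))"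

end

theory Submission
  imports Defs "HOL-Probability.Distributions"
begin

text \<open>Let \<open>\<delta> = X(\<theta>s - \<theta>bar)\<close>, which is orthogonal to \<open>X \<Theta>\<^sub>0\<close>.
  By the normal equations \<open>Estar\<close> equals the likelihood ratio of \<open>Y\<close> itself,
  \<open>exp ((\<langle>y - X \<theta>bar, \<delta>\<rangle> - |\<delta>|\<^sup>2 / 2) / \<sigma>\<^sup>2)\<close>. Orthogonality allows \<open>\<theta>bar\<close> in this formula to be
  replaced by any null parameter, so \<open>Estar\<close> tilts every null law to a probability measure and
  hence has null expectation 1. For an e-variable \<open>F\<close> the quotient \<open>F / Estar\<close> has
  \<open>\<theta>s\<close>-expectation equal to the \<open>\<theta>bar\<close>-expectation of \<open>F\<close>, so it is at most 1; Gibbs' inequality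
  then gives optimality, and its equality case gives uniqueness.\<close>

section \<open>Log-optimality\<close>

text \<open>Both parts are finite, so their difference in \<open>ereal\<close> never has the form
  infinity minus infinity. Agreement almost everywhere suffices, which suits logarithms that may be
  infinite on a null set.\<close>

lemma ext_expectation_eq_integral:
  assumes "integrable M L" and "AE y in M. Z y = ereal (L y)"
  shows "ext_expectation M Z = ereal (\<integral>y. L y \<partial>M)"
proof -
  have pos: "(\<integral>\<^sup>+ y. e2ennreal (Z y) \<partial>M) = (\<integral>\<^sup>+ y. ennreal (L y) \<partial>M)"
    and neg: "(\<integral>\<^sup>+ y. e2ennreal (- Z y) \<partial>M) = (\<integral>\<^sup>+ y. ennreal (- L y) \<partial>M)"
    using assms(2) by (auto intro!: nn_integral_cong_AE elim!: eventually_mono)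
  have "(\<integral>\<^sup>+ y. ennreal (L y) \<partial>M) \<noteq> \<infinity>" "(\<integral>\<^sup>+ y. ennreal (- L y) \<partial>M) \<noteq> \<infinity>"
    using assms(1) by (auto simp: real_integrable_def)
  then show ?thesis
    unfolding ext_expectation_def pos neg real_lebesgue_integral_def[OF assms(1)]
    by (cases "\<integral>\<^sup>+ y. ennreal (L y) \<partial>M"; cases "\<integral>\<^sup>+ y. ennreal (- L y) \<partial>M")
      (auto simp: enn2ereal_ennreal)
qed

section \<open>The extended logarithm\<close>

lemma ln_ennreal_ennreal: "0 < r \<Longrightarrow> ln_ennreal (ennreal r) = ereal (ln r)"
  by (simp add: ln_ennreal_def)

lemma ln_ennreal_measurable [measurable]: "ln_ennreal \<in> borel_measurable borel"
  unfolding ln_ennreal_def[abs_def] by measurable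

lemma e2ennreal_measurable: "e2ennreal \<in> borel_measurable borel"
  by (intro borel_measurable_continuous_onI continuous_on_e2ennreal)

text \<open>This is ln u \<le> u at u = \<open>x * exp (- g)\<close>. Integrated over the data, it
  makes the positive part of the log-growth finite.\<close>

lemma ln_ennreal_pos_part_le:
  "e2ennreal (ln_ennreal x) \<le> x * ennreal (exp (- g)) + ennreal g"
proof (cases "x = 0 \<or> x = \<infinity>")
  \<comment> \<open>At 0 the left side is 0, because \<open>e2ennreal\<close> sends -infinity to 0;
    at infinity the right side is infinite, because \<open>exp (- g)\<close> is positive.\<close>
  case True
  then show ?thesis
    by (auto simp: ln_ennreal_def e2ennreal_neg ennreal_top_mult)
next
  case False
  then obtain r where r: "x = ennreal r" "0 < r"
    by (cases x) auto
  have "ln (r * exp (- g)) \<le> r * exp (- g)"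
    using r(2) by (intro ln_bound) simp
  then have "ln r \<le> r * exp (- g) + g"
    using r(2) by (simp add: ln_mult)
  \<comment> \<open>\<open>ennreal g\<close> truncates at 0, so it equals
    \<open>ennreal (max 0 g)\<close>, and \<open>ennreal\<close> is additive only on nonnegative
    summands.\<close>
  also have "\<dots> \<le> r * exp (- g) + max 0 g"
    by simp
  finally have "ennreal (ln r) \<le> ennreal (r * exp (- g) + max 0 g)"
    by (rule ennreal_leI)
  also have "\<dots> = x * ennreal (exp (- g)) + ennreal g"
    using r by (simp add: ennreal_plus ennreal_mult max_def ennreal_neg)
  finally show ?thesis
    using r by (simp add: ln_ennreal_ennreal)
qed

text \<open>\<open>M\<close> stands for the law under the alternative, \<open>exp g\<close> for the
  candidate optimum and \<open>F\<close> for a competing e-variable. The null constraint on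
  \<open>F\<close> enters, after a change of measure, as \<open>ratio_le_1\<close>.\<close>

locale log_optimality = prob_space M for M :: "'y measure" +
  fixes g :: "'y \<Rightarrow> real" and F :: "'y \<Rightarrow> ennreal"
  assumes g_integrable: "integrable M g"
    and F_measurable [measurable]: "F \<in> borel_measurable M"
    and ratio_le_1: "(\<integral>\<^sup>+ y. F y * ennreal (exp (- g y)) \<partial>M) \<le> 1"
begin

lemma g_measurable [measurable]: "g \<in> borel_measurable M"
  using g_integrable by simp

lemma pos_part_finite: "(\<integral>\<^sup>+ y. e2ennreal (ln_ennreal (F y)) \<partial>M) < \<infinity>"
proof -
  have "(\<integral>\<^sup>+ y. e2ennreal (ln_ennreal (F y)) \<partial>M)
      \<le> (\<integral>\<^sup>+ y. F y * ennreal (exp (- g y)) + ennreal (g y) \<partial>M)"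
    by (intro nn_integral_mono ln_ennreal_pos_part_le)
  also have "\<dots> = (\<integral>\<^sup>+ y. F y * ennreal (exp (- g y)) \<partial>M) + (\<integral>\<^sup>+ y. ennreal (g y) \<partial>M)"
    by (intro nn_integral_add) measurable
  also have "\<dots> < \<infinity>"
    using ratio_le_1 g_integrable
    by (auto simp: real_integrable_def less_top[symmetric] top_unique)
  finally show ?thesis .
qed

lemma ext_expectation_ln_neg_infinite:
  assumes "(\<integral>\<^sup>+ y. e2ennreal (- ln_ennreal (F y)) \<partial>M) = \<infinity>"
  shows "ext_expectation M (\<lambda>y. ln_ennreal (F y)) = - \<infinity>"
  using pos_part_finite unfolding ext_expectation_def assms
  by (cases "\<integral>\<^sup>+ y. e2ennreal (ln_ennreal (F y)) \<partial>M") auto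

text \<open>The value infinity of \<open>F\<close> makes the positive part infinite and the value 0
  the negative part, so finite integrals confine both values to a null set.\<close>

lemma AE_finite_pos:
  assumes "(\<integral>\<^sup>+ y. e2ennreal (- ln_ennreal (F y)) \<partial>M) \<noteq> \<infinity>"
  shows "AE y in M. F y \<noteq> \<infinity> \<and> F y \<noteq> 0"
proof -
  note [measurable] = e2ennreal_measurable
  have "AE y in M. e2ennreal (ln_ennreal (F y)) \<noteq> \<infinity>"
    using pos_part_finite by (intro nn_integral_noteq_infinite) auto
  moreover have "AE y in M. e2ennreal (- ln_ennreal (F y)) \<noteq> \<infinity>"
    using assms by (intro nn_integral_noteq_infinite) auto
  ultimately show ?thesis
    by eventually_elim (auto simp: ln_ennreal_def)
qed

lemma ln_integrable:
  assumes "(\<integral>\<^sup>+ y. e2ennreal (- ln_ennreal (F y)) \<partial>M) \<noteq> \<infinity>"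
  shows "integrable M (\<lambda>y. ln (enn2real (F y)))"
    and "AE y in M. ln_ennreal (F y) = ereal (ln (enn2real (F y)))"
proof -
  show eq: "AE y in M. ln_ennreal (F y) = ereal (ln (enn2real (F y)))"
    using AE_finite_pos[OF assms] by eventually_elim (auto simp: ln_ennreal_def)
  have pos: "(\<integral>\<^sup>+ y. e2ennreal (ln_ennreal (F y)) \<partial>M) = (\<integral>\<^sup>+ y. ennreal (ln (enn2real (F y))) \<partial>M)"
    and neg: "(\<integral>\<^sup>+ y. e2ennreal (- ln_ennreal (F y)) \<partial>M) = (\<integral>\<^sup>+ y. ennreal (- ln (enn2real (F y))) \<partial>M)"
    using eq by (auto intro!: nn_integral_cong_AE elim!: eventually_mono)
  show "integrable M (\<lambda>y. ln (enn2real (F y)))"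
    using pos_part_finite assms unfolding pos neg by (simp add: real_integrable_def)
qed

text \<open>Gibbs' inequality: apply \<open>ln r \<le> r - 1\<close> to \<open>r = F / exp g\<close>.\<close>

lemma log_growth:
  shows "ext_expectation M (\<lambda>y. ln_ennreal (F y)) \<le> ereal (\<integral>y. g y \<partial>M)"
    and "ext_expectation M (\<lambda>y. ln_ennreal (F y)) = ereal (\<integral>y. g y \<partial>M) \<Longrightarrow>
      AE y in M. F y = ennreal (exp (g y))"
proof -
  let ?E = "ext_expectation M (\<lambda>y. ln_ennreal (F y))"
  have "?E \<le> ereal (\<integral>y. g y \<partial>M) \<and>
    (?E = ereal (\<integral>y. g y \<partial>M) \<longrightarrow> (AE y in M. F y = ennreal (exp (g y))))"
  proof (cases "(\<integral>\<^sup>+ y. e2ennreal (- ln_ennreal (F y)) \<partial>M) = \<infinity>")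
    \<comment> \<open>The growth is then -infinity: the bound is trivial and equality with a real
      number is impossible.\<close>
    case True
    then show ?thesis
      by (simp add: ext_expectation_ln_neg_infinite)
  next
    case False
    define L where "L y = ln (enn2real (F y))" for y
    define r where "r y = enn2real (F y) * exp (- g y)" for y
    have L: "integrable M L" and E: "?E = ereal (\<integral>y. L y \<partial>M)"
      using ln_integrable[OF False] by (auto simp: L_def[abs_def] intro: ext_expectation_eq_integral)
    note fin = AE_finite_pos[OF False]
    have r_nn: "(\<integral>\<^sup>+ y. ennreal (r y) \<partial>M) \<le> 1"
    proof -
      have "(\<integral>\<^sup>+ y. ennreal (r y) \<partial>M) = (\<integral>\<^sup>+ y. F y * ennreal (exp (- g y)) \<partial>M)"
        using fin by (intro nn_integral_cong_AE, eventually_elim)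
          (auto simp: r_def ennreal_mult less_top)
      then show ?thesis using ratio_le_1 by simp
    qed
    have [measurable]: "r \<in> borel_measurable M"
      unfolding r_def by measurable
    have r_ge_0: "0 \<le> r y" for y
      by (simp add: r_def)
    have r: "integrable M r"
      using r_nn r_ge_0 by (intro integrableI_nonneg) (auto simp: less_top[symmetric] top_unique)
    have r_int: "(\<integral>y. r y \<partial>M) \<le> 1"
      using r_nn r_ge_0 nn_integral_eq_integral[OF r] by simp
    \<comment> \<open>Since ln r = L - g, the quantity is r - 1 - ln r, which is nonnegative and
      vanishes only at r = 1, that is, where \<open>F\<close> equals \<open>exp g\<close>.\<close>
    have gap: "AE y in M. 0 \<le> g y + (r y - 1) - L y \<and>
      (g y + (r y - 1) - L y = 0 \<longrightarrow> F y = ennreal (exp (g y)))"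
      using fin
    proof eventually_elim
      case (elim y)
      then obtain f where f: "F y = ennreal f" "0 < f"
        by (cases "F y") auto
      have r_pos: "0 < r y" and ln_r: "ln (r y) = L y - g y"
        using f by (simp_all add: r_def L_def ln_mult)
      have "F y = ennreal (exp (g y))" if "r y = 1"
        using that f by (simp add: r_def exp_minus field_simps)
      then show ?case
        using ln_le_minus_one[OF r_pos] ln_eq_minus_one[OF r_pos] ln_r by auto
    qed
    have gap_int: "integrable M (\<lambda>y. g y + (r y - 1) - L y)"
      using g_integrable r L by simp
    have gap_eq: "(\<integral>y. g y + (r y - 1) - L y \<partial>M) = (\<integral>y. g y \<partial>M) + ((\<integral>y. r y \<partial>M) - 1) - (\<integral>y. L y \<partial>M)"
      using g_integrable r L by (simp add: prob_space)
    have gap_ge_0: "0 \<le> (\<integral>y. g y + (r y - 1) - L y \<partial>M)"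
      using gap by (intro integral_nonneg_AE) (auto elim: eventually_mono)
    \<comment> \<open>As \<open>r\<close> has integral at most 1, equal growth forces the gap to
      have integral 0; being nonnegative, it vanishes almost everywhere.\<close>
    have "AE y in M. F y = ennreal (exp (g y))" if "(\<integral>y. L y \<partial>M) = (\<integral>y. g y \<partial>M)"
    proof -
      have "(\<integral>y. g y + (r y - 1) - L y \<partial>M) = 0"
        using gap_ge_0 gap_eq r_int that by simp
      then have "AE y in M. g y + (r y - 1) - L y = 0"
        using gap gap_int by (subst integral_nonneg_eq_0_iff_AE[symmetric]) (auto elim: eventually_mono)
      with gap show ?thesis
        by eventually_elim auto
    qed
    then show ?thesis
      using gap_ge_0 gap_eq r_int by (simp add: E)
  qed
  then show "?E \<le> ereal (\<integral>y. g y \<partial>M)"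
    and "?E = ereal (\<integral>y. g y \<partial>M) \<Longrightarrow> AE y in M. F y = ennreal (exp (g y))"
    by auto
qed

end

section \<open>Isotropic Gaussians\<close>

text \<open>\<open>matrix_inv\<close> chooses some two-sided inverse. For square matrices a right
  inverse is also a left inverse, and the choice is then unique.\<close>

lemma matrix_inv_eqI:
  fixes A B :: "real ^ 'n ^ 'n"
  assumes "A ** B = mat 1"
  shows "matrix_inv A = B"
proof -
  have BA: "B ** A = mat 1"
    using assms by (simp add: matrix_left_right_inverse)
  have "A ** matrix_inv A = mat 1 \<and> matrix_inv A ** A = mat 1"
    unfolding matrix_inv_def by (rule someI[of _ B]) (simp add: assms BA)
  then have "B ** (A ** matrix_inv A) = B"
    by simp
  then show ?thesis
    by (simp add: matrix_mul_assoc BA)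
qed

lemma mat_vector_mult: "(mat s :: real ^ 'n ^ 'n) *v x = s *\<^sub>R x"
  by (simp add: matrix_scaleR[symmetric] matrix_works)

lemma gaussian_density_mat:
  fixes m x :: "real ^ 'n"
  assumes "0 < s"
  shows "gaussian_density m (mat s) x =
    exp (- ((x - m) \<bullet> (x - m)) / (2 * s)) / sqrt (2 * pi * s) ^ CARD('n)"
proof -
  have "(mat s :: real ^ 'n ^ 'n) ** mat (1 / s) = mat 1"
    using assms by (simp add: matrix_eq mat_vector_mult flip: matrix_vector_mul_assoc)
  then have inv: "matrix_inv (mat s :: real ^ 'n ^ 'n) = mat (1 / s)"
    by (rule matrix_inv_eqI)
  have "det (mat s :: real ^ 'n ^ 'n) = s ^ CARD('n)"
    by (subst det_diagonal) (auto simp: mat_def)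
  then have "sqrt ((2 * pi) ^ CARD('n) * det (mat s :: real ^ 'n ^ 'n)) = sqrt (2 * pi * s) ^ CARD('n)"
    by (simp add: power_mult_distrib flip: real_sqrt_power)
  then show ?thesis
    using assms by (simp add: gaussian_density_def inv mat_vector_mult)
qed

lemma gaussian_density_mat_nonneg: "0 < s \<Longrightarrow> 0 \<le> gaussian_density m (mat s) x"
  by (simp add: gaussian_density_mat)

lemma gaussian_density_mat_measurable:
  "0 < s \<Longrightarrow> gaussian_density m (mat s) \<in> borel_measurable borel"
  by (subst measurable_cong[OF gaussian_density_mat]) auto

text \<open>The density factors over the coordinates into one-dimensional normal densities of
  variance \<open>s\<close>.\<close>

lemma nn_integral_gaussian_density_mat:
  fixes m :: "real ^ 'n"
  assumes "0 < s"
  shows "(\<integral>\<^sup>+ x. ennreal (gaussian_density m (mat s) x) \<partial>lborel) = 1"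
proof -
  have sq: "(x - m) \<bullet> (x - m) = (\<Sum>b\<in>Basis. (x \<bullet> b - m \<bullet> b)\<^sup>2)" for x :: "real ^ 'n"
    by (subst euclidean_inner) (simp add: power2_eq_square inner_diff_left)
  have "gaussian_density m (mat s) x = (\<Prod>b\<in>Basis. normal_density (m \<bullet> b) (sqrt s) (x \<bullet> b))" for x
    using assms
    by (simp add: gaussian_density_mat normal_density_def sq prod_dividef exp_sum sum_negf
        sum_divide_distrib prod.distrib flip: sum_negf)
  then have "(\<integral>\<^sup>+ x. ennreal (gaussian_density m (mat s) x) \<partial>lborel) =
      (\<integral>\<^sup>+ x. (\<Prod>b\<in>Basis. ennreal (normal_density (m \<bullet> b) (sqrt s) (x \<bullet> b))) \<partial>(lborel :: (real ^ 'n) measure))"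
    by (simp add: prod_ennreal)
  also have "\<dots> = (\<Prod>b\<in>(Basis :: (real ^ 'n) set). \<integral>\<^sup>+ x. ennreal (normal_density (m \<bullet> b) (sqrt s) x) \<partial>lborel)"
    by (rule nn_integral_lborel_prod) auto
  also have "\<dots> = 1"
    using assms by (simp add: nn_integral_eq_integral)
  finally show ?thesis .
qed

text \<open>The exponential factor is the likelihood ratio of \<open>N(m + v, s I)\<close> against \<open>N(m, s I)\<close>.\<close>

lemma gaussian_density_mat_tilt:
  assumes "0 < s"
  shows "gaussian_density m (mat s) y * exp (((y - m) \<bullet> v - v \<bullet> v / 2) / s) =
    gaussian_density (m + v) (mat s) y"
proof -
  have "- ((y - m) \<bullet> (y - m)) / (2 * s) + ((y - m) \<bullet> v - v \<bullet> v / 2) / s =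
      - ((y - (m + v)) \<bullet> (y - (m + v))) / (2 * s)"
    using assms by (simp add: field_simps inner_simps inner_commute)
  then show ?thesis
    using assms by (simp add: gaussian_density_mat flip: exp_add)
qed

section \<open>Change of mean under Gaussian laws\<close>

lemma nn_integral_gaussian_mat:
  assumes "0 < s" "f \<in> borel_measurable borel"
  shows "(\<integral>\<^sup>+ y. f y \<partial>gaussian_measure m (mat s)) =
    (\<integral>\<^sup>+ y. ennreal (gaussian_density m (mat s) y) * f y \<partial>lborel)"
  unfolding gaussian_measure_def
  using assms gaussian_density_mat_measurable[OF assms(1), of m]
  by (subst nn_integral_density) auto

lemma sets_gaussian_measure [measurable_cong, simp]: "sets (gaussian_measure m S) = sets borel"
  by (simp add: gaussian_measure_def)

lemma prob_space_gaussian_mat: "0 < s \<Longrightarrow> prob_space (gaussian_measure m (mat s))"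
  using nn_integral_gaussian_mat[of s "\<lambda>_. 1" m] nn_integral_gaussian_density_mat[of s m]
  by (intro prob_spaceI) simp

lemma nn_integral_gaussian_mat_tilt:
  assumes "0 < s" and [measurable]: "f \<in> borel_measurable borel"
  shows "(\<integral>\<^sup>+ y. f y * ennreal (exp (((y - m) \<bullet> v - v \<bullet> v / 2) / s)) \<partial>gaussian_measure m (mat s)) =
    (\<integral>\<^sup>+ y. f y \<partial>gaussian_measure (m + v) (mat s))"
proof -
  have "ennreal (gaussian_density (m + v) (mat s) y) =
      ennreal (gaussian_density m (mat s) y) * ennreal (exp (((y - m) \<bullet> v - v \<bullet> v / 2) / s))" for y
    using assms(1) by (simp add: gaussian_density_mat_nonneg flip: gaussian_density_mat_tilt ennreal_mult)
  then show ?thesis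
    using assms(1) by (simp add: nn_integral_gaussian_mat mult_ac)
qed

text \<open>Domination by |t| \<le> exp t + exp (-t): up to a constant factor, both exponentials are
  likelihood ratios, for the shifts \<open>v\<close> and \<open>- v\<close>, and so have finite
  integral.\<close>

lemma integrable_gaussian_mat_inner:
  assumes "0 < s"
  shows "integrable (gaussian_measure m (mat s)) (\<lambda>y. (y - m) \<bullet> v)"
proof -
  let ?N = "gaussian_measure m (mat s)"
  interpret prob_space ?N
    using assms by (rule prob_space_gaussian_mat)
  have exp_int: "integrable ?N (\<lambda>y. exp (((y - m) \<bullet> w - w \<bullet> w / 2) / s))" for w
  proof (rule integrableI_nonneg)
    have "(\<integral>\<^sup>+ y. ennreal (exp (((y - m) \<bullet> w - w \<bullet> w / 2) / s)) \<partial>?N) = 1"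
      using nn_integral_gaussian_mat_tilt[OF assms, of "\<lambda>_. 1" m w] prob_space_gaussian_mat[OF assms, of "m + w"]
      by (simp add: prob_space.emeasure_space_1)
    then show "(\<integral>\<^sup>+ y. ennreal (exp (((y - m) \<bullet> w - w \<bullet> w / 2) / s)) \<partial>?N) < \<infinity>"
      by simp
  qed auto
  have "integrable ?N (\<lambda>y. ((y - m) \<bullet> v - v \<bullet> v / 2) / s)"
  proof (rule Bochner_Integration.integrable_bound)
    show "integrable ?N (\<lambda>y. exp (((y - m) \<bullet> v - v \<bullet> v / 2) / s) +
        exp (((y - m) \<bullet> (- v) - (- v) \<bullet> (- v) / 2) / s) * exp (v \<bullet> v / s))"
      using exp_int by (intro Bochner_Integration.integrable_add integrable_mult_left)
    have abs_le: "\<bar>t\<bar> \<le> exp t + exp (- t)" for t :: real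
      using exp_ge_add_one_self[of t] exp_ge_add_one_self[of "- t"] exp_gt_zero[of t] exp_gt_zero[of "- t"]
      by linarith
    \<comment> \<open>The shift by \<open>- v\<close> reverses the linear term but not the quadratic
      one; the factor \<open>exp (v \<bullet> v / s)\<close> corrects the latter.\<close>
    have flip: "exp (((y - m) \<bullet> (- v) - (- v) \<bullet> (- v) / 2) / s) * exp (v \<bullet> v / s) =
        exp (- (((y - m) \<bullet> v - v \<bullet> v / 2) / s))" for y
      using assms by (simp add: field_simps flip: exp_add)
    show "AE y in ?N. norm (((y - m) \<bullet> v - v \<bullet> v / 2) / s) \<le>
        norm (exp (((y - m) \<bullet> v - v \<bullet> v / 2) / s) +
          exp (((y - m) \<bullet> (- v) - (- v) \<bullet> (- v) / 2) / s) * exp (v \<bullet> v / s))"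
      unfolding flip real_norm_def by (intro AE_I2 order_trans[OF abs_le abs_ge_self])
  qed simp
  then have "integrable ?N (\<lambda>y. s * (((y - m) \<bullet> v - v \<bullet> v / 2) / s) + v \<bullet> v / 2)"
    by (intro Bochner_Integration.integrable_add integrable_mult_right) simp_all
  then show ?thesis
    using assms by simp
qed

section \<open>The linear model\<close>

lemma inner_gram_mult: "v \<bullet> ((transpose X ** X) *v w) = (X *v v) \<bullet> (X *v w)"
  for X :: "real ^ 'k ^ 'n"
  using dot_lmul_matrix[of "X *v w" X v]
  by (simp add: inner_commute flip: matrix_vector_mul_assoc)

text \<open>A kernel vector \<open>v\<close> of the Gram matrix satisfies |X v|^2 = 0, and full
  column rank makes \<open>X\<close> injective.\<close>

lemma gram_invertible:
  fixes X :: "real ^ 'k ^ 'n"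
  assumes "rank X = CARD('k)"
  shows "invertible (transpose X ** X)"
proof -
  have "v = 0" if "(transpose X ** X) *v v = 0" for v
  proof -
    have "(X *v v) \<bullet> (X *v v) = 0"
      using that by (simp flip: inner_gram_mult)
    then show "v = 0"
      using assms full_rank_injective[of X] injD[of "(*v) X" v 0] by simp
  qed
  then show ?thesis
    by (simp add: invertible_left_inverse matrix_left_invertible_ker)
qed

lemma weighted_dist_eq:
  "weighted_dist X s \<theta>s \<theta> = (X *v (\<theta>s - \<theta>)) \<bullet> (X *v (\<theta>s - \<theta>)) / s"
  by (simp add: weighted_dist_def inner_gram_mult divide_inverse mult.commute
      flip: scaleR_matrix_vector_assoc)

text \<open>The normal equations in weak form: the residual of the least squares fit is orthogonal
  to the column space of \<open>X\<close>.\<close>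

lemma inner_least_squares:
  fixes X :: "real ^ 'k ^ 'n"
  assumes "rank X = CARD('k)"
  shows "(X *v least_squares X y) \<bullet> (X *v v) = y \<bullet> (X *v v)"
proof -
  let ?G = "transpose X ** X"
  obtain H where H: "?G ** H = mat 1"
    using gram_invertible[OF assms] by (auto simp: invertible_def)
  have "?G *v least_squares X y = (?G ** H) *v (transpose X *v y)"
    by (simp add: least_squares_def matrix_inv_eqI[OF H] flip: matrix_vector_mul_assoc)
  then have "?G *v least_squares X y = transpose X *v y"
    by (simp add: H)
  then have "v \<bullet> (?G *v least_squares X y) = v \<bullet> (transpose X *v y)"
    by simp
  then show ?thesis
    by (simp add: inner_gram_mult dot_lmul_matrix inner_commute[of v] inner_commute[of "X *v v"])
qed

text \<open>The quadratic parts of the exponents cancel, and the normal equations let \<open>y\<close> replace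
  \<open>X *v least_squares X y\<close> in what remains.\<close>

lemma density_ratio_least_squares:
  fixes X :: "real ^ 'k ^ 'n" and \<theta>1 \<theta>2 :: "real ^ 'k"
  assumes "rank X = CARD('k)" and "0 < s"
  defines "S \<equiv> s *\<^sub>R matrix_inv (transpose X ** X)"
  defines "\<delta> \<equiv> X *v (\<theta>1 - \<theta>2)"
  shows "gaussian_density \<theta>1 S (least_squares X y) / gaussian_density \<theta>2 S (least_squares X y) =
    exp (((y - X *v \<theta>2) \<bullet> \<delta> - \<delta> \<bullet> \<delta> / 2) / s)"
proof -
  let ?G = "transpose X ** X" and ?t = "least_squares X y"
  obtain H where H: "?G ** H = mat 1" and HG: "H ** ?G = mat 1"
    using gram_invertible[OF assms(1)] by (auto simp: invertible_def)
  have S: "S = s *\<^sub>R H"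
    by (simp add: S_def matrix_inv_eqI[OF H])
  have SG: "S ** ((1 / s) *\<^sub>R ?G) = mat 1"
  proof -
    have "S *v (((1 / s) *\<^sub>R ?G) *v x) = (H ** ?G) *v x" for x
    proof -
      have "S *v (((1 / s) *\<^sub>R ?G) *v x) = s *\<^sub>R (H *v ((1 / s) *\<^sub>R (?G *v x)))"
        by (simp only: S scaleR_matrix_vector_assoc)
      also have "\<dots> = H *v (?G *v x)"
        using assms(2) by (simp only: matrix_vector_mult_scaleR) simp
      finally show ?thesis
        by (simp only: matrix_vector_mul_assoc)
    qed
    then show ?thesis
      by (simp add: matrix_eq HG flip: matrix_vector_mul_assoc)
  qed
  then have inv: "matrix_inv S = (1 / s) *\<^sub>R ?G"
    by (rule matrix_inv_eqI)
  have "invertible S"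
    using SG by (auto simp: invertible_right_inverse)
  \<comment> \<open>Ensures that the common normalising factor is nonzero and cancels in the
    ratio.\<close>
  then have det: "det S \<noteq> 0"
    by (simp add: invertible_det_nz)
  have quad: "(?t - \<theta>) \<bullet> (matrix_inv S *v (?t - \<theta>)) = (X *v (?t - \<theta>)) \<bullet> (X *v (?t - \<theta>)) / s" for \<theta>
    by (simp add: inv inner_gram_mult flip: scaleR_matrix_vector_assoc)
  have X\<theta>1: "X *v \<theta>1 = X *v \<theta>2 + \<delta>"
    by (simp add: \<delta>_def matrix_vector_mult_diff_distrib)
  have normal: "(X *v ?t) \<bullet> \<delta> = y \<bullet> \<delta>"
    unfolding \<delta>_def by (rule inner_least_squares[OF assms(1)])
  have "(X *v (?t - \<theta>2)) \<bullet> (X *v (?t - \<theta>2)) - (X *v (?t - \<theta>1)) \<bullet> (X *v (?t - \<theta>1)) =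
      2 * ((X *v ?t - X *v \<theta>2) \<bullet> \<delta>) - \<delta> \<bullet> \<delta>"
    by (simp add: matrix_vector_mult_diff_distrib X\<theta>1 inner_simps inner_commute)
  also have "\<dots> = 2 * ((y - X *v \<theta>2) \<bullet> \<delta>) - \<delta> \<bullet> \<delta>"
    by (simp add: inner_diff_left normal)
  finally have diff: "(X *v (?t - \<theta>2)) \<bullet> (X *v (?t - \<theta>2)) - (X *v (?t - \<theta>1)) \<bullet> (X *v (?t - \<theta>1)) =
      2 * ((y - X *v \<theta>2) \<bullet> \<delta>) - \<delta> \<bullet> \<delta>" .
  have "gaussian_density \<theta>1 S ?t / gaussian_density \<theta>2 S ?t =
      exp (- ((X *v (?t - \<theta>1)) \<bullet> (X *v (?t - \<theta>1)) / s / 2)) / exp (- ((X *v (?t - \<theta>2)) \<bullet> (X *v (?t - \<theta>2)) / s / 2))"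
    using det by (simp add: gaussian_density_def quad)
  also have "\<dots> = exp (((X *v (?t - \<theta>2)) \<bullet> (X *v (?t - \<theta>2)) - (X *v (?t - \<theta>1)) \<bullet> (X *v (?t - \<theta>1))) / (2 * s))"
    by (simp add: diff_divide_distrib mult.commute flip: exp_diff)
  also have "\<dots> = exp (((y - X *v \<theta>2) \<bullet> \<delta> - \<delta> \<bullet> \<delta> / 2) / s)"
    unfolding diff using assms(2) by (simp add: field_simps)
  finally show ?thesis .
qed

section \<open>Projection onto the null model\<close>

lemma subspace_null_params: "subspace (null_params A)"
  by (auto simp: subspace_def null_params_def)

text \<open>\<open>X *v \<theta>0\<close> is the orthogonal projection of
  \<open>X *v \<theta>s\<close> onto the space of null means. Pythagoras makes
  \<open>\<theta>0\<close> a minimiser, and injectivity of \<open>X\<close> makes it the only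
  one.\<close>

lemma weighted_projection:
  fixes X :: "real ^ 'k ^ 'n"
  assumes "rank X = CARD('k)" and "0 < s"
  obtains \<theta>0 where "\<theta>0 \<in> null_params A"
    and "\<forall>\<theta>\<in>null_params A. (X *v \<theta>) \<bullet> (X *v (\<theta>s - \<theta>0)) = 0"
    and "\<forall>\<theta>. is_arg_min (weighted_dist X s \<theta>s) (\<lambda>\<theta>. \<theta> \<in> null_params A) \<theta> \<longleftrightarrow> \<theta> = \<theta>0"
proof -
  let ?V = "(*v) X ` null_params A"
  have V: "span ?V = ?V"
    by (simp add: span_eq_iff subspace_null_params linear_subspace_image)
  obtain p z where p: "p \<in> ?V" and z: "\<And>w. w \<in> ?V \<Longrightarrow> orthogonal z w" and pz: "X *v \<theta>s = p + z"
    using orthogonal_subspace_decomp_exists[of ?V "X *v \<theta>s"] V by auto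
  obtain \<theta>0 where \<theta>0: "\<theta>0 \<in> null_params A" "p = X *v \<theta>0"
    using p by auto
  have z_eq: "z = X *v (\<theta>s - \<theta>0)"
    using pz by (simp add: \<theta>0 matrix_vector_mult_diff_distrib)
  have ortho: "(X *v \<theta>) \<bullet> (X *v (\<theta>s - \<theta>0)) = 0" if "\<theta> \<in> null_params A" for \<theta>
    using z[of "X *v \<theta>"] that by (simp add: z_eq orthogonal_def inner_commute)
  have pyth: "weighted_dist X s \<theta>s \<theta> =
      weighted_dist X s \<theta>s \<theta>0 + (X *v (\<theta>0 - \<theta>)) \<bullet> (X *v (\<theta>0 - \<theta>)) / s" if "\<theta> \<in> null_params A" for \<theta>
  proof -
    have split: "X *v (\<theta>s - \<theta>) = X *v (\<theta>s - \<theta>0) + X *v (\<theta>0 - \<theta>)"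
      by (simp flip: matrix_vector_right_distrib)
    have "(X *v (\<theta>0 - \<theta>)) \<bullet> (X *v (\<theta>s - \<theta>0)) = 0"
      by (intro ortho subspace_diff subspace_null_params \<theta>0 that)
    then show ?thesis
      unfolding weighted_dist_eq split
      by (simp add: inner_add_left inner_add_right inner_commute add_divide_distrib)
  qed
  have strict: "weighted_dist X s \<theta>s \<theta>0 < weighted_dist X s \<theta>s \<theta>"
    if "\<theta> \<in> null_params A" "\<theta> \<noteq> \<theta>0" for \<theta>
  proof -
    have "X *v (\<theta>0 - \<theta>) \<noteq> 0"
      using assms(1) full_rank_injective[of X] injD[of "(*v) X" "\<theta>0 - \<theta>" 0] that(2) by auto
    then show ?thesis
      using assms(2) by (simp add: pyth[OF that(1)])
  qed
  have "is_arg_min (weighted_dist X s \<theta>s) (\<lambda>\<theta>. \<theta> \<in> null_params A) \<theta> \<longleftrightarrow> \<theta> = \<theta>0" for \<theta>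
    unfolding is_arg_min_def using \<theta>0(1) strict by (metis less_asym)
  with \<theta>0(1) ortho show thesis
    by (intro that[of \<theta>0]) auto
qed

text \<open>The first two conjuncts make the others meaningful, since \<open>arg_min_on\<close> and
  \<open>ext_expectation\<close> are total. Uniqueness is almost everywhere because changing an
  e-variable at a single point affects no expectation here.\<close>

theorem mainTheorem8:
  fixes X :: "real ^ 'k ^ 'n" and \<sigma> :: real and A :: "'k set"
    and \<theta>s \<theta>bar :: "real ^ 'k" and Estar :: "real ^ 'n \<Rightarrow> ennreal"
  assumes full_rank: "rank X = CARD('k)"
    and sigma: "\<sigma>\<^sup>2 > 0"
    and theta_a: "\<exists>i\<in>A. \<theta>s $ i \<noteq> 0"
    and theta_bar: "\<theta>bar = arg_min_on (weighted_dist X (\<sigma>\<^sup>2) \<theta>s) (null_params A)"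
    and Estar: "Estar = (\<lambda>y. ennreal
      (gaussian_density \<theta>s (\<sigma>\<^sup>2 *\<^sub>R matrix_inv (transpose X ** X)) (least_squares X y) /
       gaussian_density \<theta>bar (\<sigma>\<^sup>2 *\<^sub>R matrix_inv (transpose X ** X)) (least_squares X y)))"
  shows "(\<exists>!\<theta>. is_arg_min (weighted_dist X (\<sigma>\<^sup>2) \<theta>s) (\<lambda>\<theta>. \<theta> \<in> null_params A) \<theta>) \<and>
    (\<forall>F\<in>e_variables (linear_model X (\<sigma>\<^sup>2)) (null_params A).
        ext_expectation_defined (linear_model X (\<sigma>\<^sup>2) \<theta>s) (\<lambda>y. ln_ennreal (F y))) \<and>
    is_gro (linear_model X (\<sigma>\<^sup>2)) (null_params A) \<theta>s Estar \<and>
    (\<forall>F. is_gro (linear_model X (\<sigma>\<^sup>2)) (null_params A) \<theta>s F \<longrightarrow>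
        (AE y in linear_model X (\<sigma>\<^sup>2) \<theta>s. F y = Estar y))"
proof -
  define s where "s = \<sigma>\<^sup>2"
  have s: "0 < s"
    using sigma by (simp add: s_def)
  obtain \<theta>0 where \<theta>0: "\<theta>0 \<in> null_params A"
    and ortho: "\<And>\<theta>. \<theta> \<in> null_params A \<Longrightarrow> (X *v \<theta>) \<bullet> (X *v (\<theta>s - \<theta>0)) = 0"
    and argmin: "\<And>\<theta>. is_arg_min (weighted_dist X s \<theta>s) (\<lambda>\<theta>. \<theta> \<in> null_params A) \<theta> \<longleftrightarrow> \<theta> = \<theta>0"
    using weighted_projection[OF full_rank s, where A = A and \<theta>s = \<theta>s] by metis
  \<comment> \<open>\<open>arg_min_on\<close> is a choice operator, pinned down here by uniqueness
    of the minimiser.\<close>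
  have \<theta>bar: "\<theta>bar = \<theta>0"
    by (simp add: theta_bar arg_min_on_def arg_min_def argmin flip: s_def)
  define \<delta> where "\<delta> = X *v (\<theta>s - \<theta>0)"
  define g where "g y = ((y - X *v \<theta>0) \<bullet> \<delta> - \<delta> \<bullet> \<delta> / 2) / s" for y
  have Estar_exp: "Estar y = ennreal (exp (g y))" for y
    using density_ratio_least_squares[OF full_rank s, where ?\<theta>1.0 = \<theta>s and ?\<theta>2.0 = \<theta>0 and y = y]
    by (simp add: Estar \<theta>bar g_def \<delta>_def flip: s_def)
  let ?P = "linear_model X s" and ?N = "null_params A"
  have P: "?P \<theta> = gaussian_measure (X *v \<theta>) (mat s)" for \<theta>
    by (simp add: linear_model_def)
  have X\<theta>s: "X *v \<theta>s = X *v \<theta>0 + \<delta>"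
    by (simp add: \<delta>_def matrix_vector_mult_diff_distrib)
  have [measurable]: "g \<in> borel_measurable borel"
    unfolding g_def by measurable
  have Estar_evar: "Estar \<in> e_variables ?P ?N"
  proof -
    have "(\<integral>\<^sup>+ y. Estar y \<partial>?P \<theta>) = 1" if "\<theta> \<in> ?N" for \<theta>
    proof -
      \<comment> \<open>Both null means are orthogonal to \<open>\<delta>\<close>, so under every
        null law \<open>exp (g y)\<close> is the likelihood ratio for a shift of the mean by
        \<open>\<delta>\<close>.\<close>
      have "(y - X *v \<theta>0) \<bullet> \<delta> = (y - X *v \<theta>) \<bullet> \<delta>" for y
        using ortho[OF that] ortho[OF \<theta>0] by (simp add: \<delta>_def inner_diff_left)
      then have "(\<integral>\<^sup>+ y. Estar y \<partial>?P \<theta>) = (\<integral>\<^sup>+ y. 1 \<partial>gaussian_measure (X *v \<theta> + \<delta>) (mat s))"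
        using nn_integral_gaussian_mat_tilt[OF s, of "\<lambda>_. 1" "X *v \<theta>" \<delta>] by (simp add: P Estar_exp g_def)
      also have "\<dots> = 1"
        using prob_space.emeasure_space_1[OF prob_space_gaussian_mat[OF s]] by simp
      finally show ?thesis .
    qed
    moreover have "Estar \<in> borel_measurable borel"
      unfolding Estar_exp[abs_def] by measurable
    ultimately show ?thesis
      by (simp add: e_variables_def)
  qed
  \<comment> \<open>Recentring at the alternative mean turns
    \<open>- \<delta> \<bullet> \<delta> / 2\<close> into
    \<open>+ \<delta> \<bullet> \<delta> / 2\<close>.\<close>
  have g_shift: "g y = ((y - X *v \<theta>s) \<bullet> \<delta> + \<delta> \<bullet> \<delta> / 2) / s" for y
    by (simp add: g_def X\<theta>s inner_simps)
  have g_int: "integrable (?P \<theta>s) g"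
  proof -
    interpret prob_space "?P \<theta>s"
      unfolding P using s by (rule prob_space_gaussian_mat)
    show ?thesis
      unfolding g_shift[abs_def] using integrable_gaussian_mat_inner[OF s, of "X *v \<theta>s" \<delta>]
      by (simp flip: P)
  qed
  have opt: "log_optimality (?P \<theta>s) g F" if F: "F \<in> e_variables ?P ?N" for F
  proof -
    have [measurable]: "F \<in> borel_measurable borel" and le: "(\<integral>\<^sup>+ y. F y \<partial>?P \<theta>0) \<le> 1"
      using F \<theta>0 by (auto simp: e_variables_def)
    \<comment> \<open>So \<open>exp (- g y)\<close> is the likelihood ratio for the shift by
      \<open>- \<delta>\<close>, which carries the law at \<open>\<theta>s\<close> back to the null
      law at \<open>\<theta>0\<close>.\<close>
    have "- g y = ((y - X *v \<theta>s) \<bullet> (- \<delta>) - (- \<delta>) \<bullet> (- \<delta>) / 2) / s" for y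
      using s by (simp add: g_shift field_simps)
    then have "(\<integral>\<^sup>+ y. F y * ennreal (exp (- g y)) \<partial>?P \<theta>s) = (\<integral>\<^sup>+ y. F y \<partial>?P \<theta>0)"
      using nn_integral_gaussian_mat_tilt[OF s, of F "X *v \<theta>s" "- \<delta>"] by (simp add: P X\<theta>s)
    moreover have "F \<in> borel_measurable (?P \<theta>s)"
      unfolding P by measurable
    ultimately show ?thesis
      using le g_int prob_space_gaussian_mat[OF s, of "X *v \<theta>s"]
      by (simp add: log_optimality_def log_optimality_axioms_def flip: P)
  qed
  let ?U = "\<lambda>F. ext_expectation (?P \<theta>s) (\<lambda>y. ln_ennreal (F y))"
  have U_Estar: "?U Estar = ereal (\<integral>y. g y \<partial>?P \<theta>s)"
    using g_int by (intro ext_expectation_eq_integral) (simp_all add: Estar_exp ln_ennreal_ennreal)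
  have sup: "(SUP F\<in>e_variables ?P ?N. ?U F) = ereal (\<integral>y. g y \<partial>?P \<theta>s)"
  proof (rule antisym)
    show "(SUP F\<in>e_variables ?P ?N. ?U F) \<le> ereal (\<integral>y. g y \<partial>?P \<theta>s)"
      using opt by (intro SUP_least log_optimality.log_growth(1))
    show "ereal (\<integral>y. g y \<partial>?P \<theta>s) \<le> (SUP F\<in>e_variables ?P ?N. ?U F)"
      using SUP_upper[OF Estar_evar, of ?U] by (simp add: U_Estar)
  qed
  have "AE y in ?P \<theta>s. F y = Estar y" if "is_gro ?P ?N \<theta>s F" for F
    using that log_optimality.log_growth(2)[OF opt] by (simp add: is_gro_def sup Estar_exp)
  moreover have "is_gro ?P ?N \<theta>s Estar"
    by (simp add: is_gro_def Estar_evar U_Estar sup)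
  moreover have "ext_expectation_defined (?P \<theta>s) (\<lambda>y. ln_ennreal (F y))" if "F \<in> e_variables ?P ?N" for F
    using log_optimality.pos_part_finite[OF opt[OF that]] by (simp add: ext_expectation_defined_def)
  ultimately show ?thesis
    unfolding s_def[symmetric] argmin by blast
qed

end
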